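(* Let $p$ be a program, $H$ an architecture and $\alpha$ an abstraction mapping for $p$. If $p\approx_H p^\alpha$, then $$\mathrm{WCET}(p,H)=\mathrm{WCET}(p^\alpha,H).$$
   Context: Programs and states. $\mathcal R$ is a finite set of registers containing a designated register $\mathbf{pc}$ (program counter; the status bits are regarded as part of $\mathbf{pc}$), $\mathcal M$ is a finite set of memory cell addresses, $\mathcal D$ is a finite domain. A state is a map $v:\mathcal R\cup\mathcal M\to\mathcal D$; $\mathcal V$ is the set of states. A program $p$ is a finite list of instructions $i_1,i_2,\dots$ with initial instruction $i_1$. Each instruction $\iota$ (operands included) has a deterministic semantics $[\![\iota]\!]:\mathcal V\to\mathcal V$; a fixed duration in each stage of the processor pipeline, independent of operand contents; a set $\mathrm{regR}(\iota)$ of registers it reads and a set $\mathrm{regW}(\iota)$ of registers it writes; and sets $\mathrm{memR}(\iota),\mathrm{memW}(\iota)$ of memory cell addresses it reads from and writes to when executed. If $\iota$ references memory cells, the referenced addresses are computed from the values, in the state in which $\iota$ is executed, of the registers in $\mathrm{regR}(\iota)\cup\mathrm{regW}(\iota)$. In state $v$ the instruction executed is the one pointed to by $v(\mathbf{pc})$; $\mathbf{pc}$ is incremented by $1$ after each instruction, except for branching instructions. Runs. The run of $p$ from $v_0$ is the unique sequence $\rho(p,v_0)=\iota_1\cdots\iota_n$ of instructions performed by $p$ from $v_0$, with $\iota_1=i_1$ and states $v_{j+1}=[\![\iota_{j+1}]\!](v_j)$. Every run terminates, and there is a constant $K_p$ bounding the length of all runs of $p$. Execution time. An architecture $H$ consists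 of the pipeline structure, caches (initial state, size, replacement policy), main memory, and their timing specifications. Two runs $\rho=\iota_1\cdots\iota_n$ and $\rho'=\iota_1'\cdots\iota_n'$ are $H$-equivalent, $\rho\approx_H\rho'$, if for each $1\le k\le n$: $\iota_k$ and $\iota_k'$ have the same duration in each pipeline stage, and the registers used and memory cells referenced are the same, i.e. $\phi(\iota_k)=\phi(\iota'_k)$ for $\phi\in\{\mathrm{regR},\mathrm{regW},\mathrm{memR},\mathrm{memW}\}$ (for $\mathrm{memR},\mathrm{memW}$: the addresses actually referenced at step $k$). The execution time $\mathrm{time}_H(\rho)$ of a run is a function completely determined by $H$ and by these data, so $\rho\approx_H\rho'$ implies $\mathrm{time}_H(\rho)=\mathrm{time}_H(\rho')$. Critical instructions. An instruction is critical if (i) it sets some status bits (e.g. a comparison or test, or an arithmetic instruction that sets flags), or (ii) it references a memory cell. Abstraction. For an instruction $\iota$, the abstracted instruction $\iota^a$ has semantics $[\![\iota^a]\!](v)=v'$ with $v'(x)=v(x)$ for every register $x\ne\mathbf{pc}$ and every memory cell $x\in\mathcal M$, and $v'(\mathbf{pc})=v(\mathbf{pc})+1$; it has the same duration as $\iota$ in each pipeline stage, and $\phi(\iota^a)=\phi(\iota)$ for $\phi\in\{\mathrm{regR},\mathrm{regW},\mathrm{memR},\mathrm{memW}\}$ (with addresses computed from operand registers in the same way). An abstraction mapping $\alpha$ assigns to each instruction $\iota$ of $p$ either $\iota$ or $\iota^a$; write $\iota^\alpha=\alpha(\iota)$, and $p^\alpha$ for the program obtained by replacing each instruction $\iota$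 of $p$ by $\iota^\alpha$. The $\alpha$-abstracted run corresponding to $\rho(p,v_0)=\iota_1\cdots\iota_k$ is $\rho(p^\alpha,v_0)=\iota_1^\alpha\cdots\iota_k^\alpha$, with states $v_0^\alpha=v_0$, $v^\alpha_{j+1}=[\![\iota^\alpha_{j+1}]\!](v^\alpha_j)$. Worst-case execution time. Let $\mathcal V_0\subseteq\mathcal V$ be the (finite, nonempty) set of initial states given by the possible input data. Then $\mathrm{WCET}(p,H)=\max_{v_0\in\mathcal V_0}\mathrm{time}_H(\rho(p,v_0))$ and $\mathrm{WCET}(p^\alpha,H)=\max_{v_0\in\mathcal V_0}\mathrm{time}_H(\rho(p^\alpha,v_0))$. Program equivalence. $p\approx_H p^\alpha$ means: for every initial state $v_0\in\mathcal V_0$, writing $\rho(p,v_0)=\iota_1\cdots\iota_k$ with states $v_j$ and $\rho(p^\alpha,v_0)$ with states $v_j^\alpha$, for every $j$ such that $\iota_{j+1}$ is critical one has $v_j(r)=v_j^\alpha(r)$ for all $r\in\mathrm{regR}(\iota_{j+1})\cup\mathrm{regW}(\iota_{j+1})$. *)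

theory Defs
  imports Complex_Main
begin

type_synonym ('r, 'm, 'd) state = "'r + 'm \<Rightarrow> 'd"

text \<open>
  A content \<open>d\<close> of \<open>pc\<close> encodes both the (zero-based) position \<open>ptr d\<close> in the program and the
  status bits \<open>flag f d\<close>.
\<close>
record ('r, 'd, 'f) cpu =
  pc :: 'r
  ptr :: "'d \<Rightarrow> nat"
  flag :: "'f \<Rightarrow> 'd \<Rightarrow> bool"

text \<open>
  \<open>memR i v\<close> and \<open>memW i v\<close> are the addresses referenced when the instruction is executed in
  state \<open>v\<close>; \<open>statW\<close> is the set of status bits that the instruction sets.
\<close>
record ('r, 'm, 'd, 'f, 's) instr =
  sem :: "('r, 'm, 'd) state \<Rightarrow> ('r, 'm, 'd) state"
  dur :: "'s \<Rightarrow> real"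
  regR :: "'r set"
  regW :: "'r set"
  memR :: "('r, 'm, 'd) state \<Rightarrow> 'm set"
  memW :: "('r, 'm, 'd) state \<Rightarrow> 'm set"
  statW :: "'f set"
  branching :: bool

type_synonym ('r, 'm, 'd, 'f, 's) program = "('r, 'm, 'd, 'f, 's) instr list"

text \<open>
  The domain is finite, so \<open>d + 1\<close> can only be required to be the next program position while
  \<open>d\<close> still points into a program of length \<open>n\<close>.
\<close>
definition wf_cpu :: "('r, 'd::{plus,one}, 'f) cpu \<Rightarrow> nat \<Rightarrow> bool" where
  "wf_cpu M n \<longleftrightarrow>
     (\<forall>d. ptr M d < n \<longrightarrow> ptr M (d + 1) = ptr M d + 1 \<and> (\<forall>f. flag M f (d + 1) = flag M f d))"

text \<open>
  In order: addresses are computed from operand registers; only the declared locations and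
  \<open>pc\<close> are written; the effect depends only on the locations read and on \<open>pc\<close> (a location may
  also be left alone in both states, as by a conditional move); only the declared status bits
  change; \<open>pc\<close> advances by one position unless the instruction branches.
\<close>
definition wf_instr ::
  "('r, 'd::{plus,one}, 'f) cpu \<Rightarrow> nat \<Rightarrow> ('r, 'm, 'd, 'f, 's) instr \<Rightarrow> bool" where
  "wf_instr M n i \<longleftrightarrow>
     (\<forall>v v'. (\<forall>r \<in> regR i \<union> regW i. v (Inl r) = v' (Inl r)) \<longrightarrow>
        memR i v = memR i v' \<and> memW i v = memW i v') \<and>
     (\<forall>v r. r \<notin> insert (pc M) (regW i) \<longrightarrow> sem i v (Inl r) = v (Inl r)) \<and>
     (\<forall>v a. a \<notin> memW i v \<longrightarrow> sem i v (Inr a) = v (Inr a)) \<and>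
     (\<forall>v v'. (\<forall>r \<in> insert (pc M) (regR i). v (Inl r) = v' (Inl r)) \<and>
        memR i v = memR i v' \<and> memW i v = memW i v' \<and>
        (\<forall>a \<in> memR i v. v (Inr a) = v' (Inr a)) \<longrightarrow>
        (\<forall>x. sem i v x = sem i v' x \<or> sem i v x = v x \<and> sem i v' x = v' x)) \<and>
     (\<forall>v. ptr M (v (Inl (pc M))) < n \<longrightarrow>
        (\<forall>f. f \<notin> statW i \<longrightarrow>
           flag M f (sem i v (Inl (pc M))) = flag M f (v (Inl (pc M)))) \<and>
        (\<not> branching i \<longrightarrow> ptr M (sem i v (Inl (pc M))) = ptr M (v (Inl (pc M))) + 1))"

definition wf_program ::
  "('r, 'd::{plus,one}, 'f) cpu \<Rightarrow> ('r, 'm, 'd, 'f, 's) program \<Rightarrow> bool" where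
  "wf_program M p \<longleftrightarrow>
     p \<noteq> [] \<and> wf_cpu M (length p) \<and> (\<forall>i \<in> set p. wf_instr M (length p) i)"

definition state_after ::
  "('r, 'm, 'd) state \<Rightarrow> ('r, 'm, 'd, 'f, 's) instr list \<Rightarrow> nat \<Rightarrow> ('r, 'm, 'd) state" where
  "state_after v0 \<rho> j = fold sem (take j \<rho>) v0"

text \<open>
  A path is the sequence of program positions visited. Positions rather than instructions are
  recorded because an abstraction may treat two occurrences of the same instruction
  differently. Execution stops as soon as \<open>pc\<close> points to no instruction of the program.
\<close>
definition is_path ::
  "('r, 'd, 'f) cpu \<Rightarrow> ('r, 'm, 'd, 'f, 's) program \<Rightarrow> ('r, 'm, 'd) state \<Rightarrow> nat list \<Rightarrow> bool" where
  "is_path M p v0 xs \<longleftrightarrow>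
     (\<forall>j < length xs. xs ! j < length p \<and>
        ptr M (state_after v0 (map ((!) p) xs) j (Inl (pc M))) = xs ! j) \<and>
     ptr M (state_after v0 (map ((!) p) xs) (length xs) (Inl (pc M))) \<ge> length p"

definition path ::
  "('r, 'd, 'f) cpu \<Rightarrow> ('r, 'm, 'd, 'f, 's) program \<Rightarrow> ('r, 'm, 'd) state \<Rightarrow> nat list" where
  "path M p v0 = (THE xs. is_path M p v0 xs)"

definition run ::
  "('r, 'd, 'f) cpu \<Rightarrow> ('r, 'm, 'd, 'f, 's) program \<Rightarrow> ('r, 'm, 'd) state
     \<Rightarrow> ('r, 'm, 'd, 'f, 's) instr list" where
  "run M p v0 = map ((!) p) (path M p v0)"

definition initial_states :: "('r, 'd, 'f) cpu \<Rightarrow> ('r, 'm, 'd) state set \<Rightarrow> bool" where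
  "initial_states M V0 \<longleftrightarrow>
     finite V0 \<and> V0 \<noteq> {} \<and> (\<forall>v \<in> V0. ptr M (v (Inl (pc M))) = 0)"

definition terminating ::
  "('r, 'd, 'f) cpu \<Rightarrow> ('r, 'm, 'd, 'f, 's) program \<Rightarrow> ('r, 'm, 'd) state set \<Rightarrow> bool" where
  "terminating M p V0 \<longleftrightarrow> (\<exists>K. \<forall>v \<in> V0. \<exists>xs. is_path M p v xs \<and> length xs \<le> K)"

text \<open>
  Pipeline structure, caches and main memory enter only through the resulting execution time.
  An execution is given by its initial state and its instruction sequence, as the addresses
  referenced depend on the state in which an instruction is executed.
\<close>
record ('r, 'm, 'd, 'f, 's) arch =
  stages :: "'s set"
  time :: "('r, 'm, 'd) state \<Rightarrow> ('r, 'm, 'd, 'f, 's) instr list \<Rightarrow> real"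

definition H_equiv ::
  "('r, 'm, 'd, 'f, 's) arch \<Rightarrow>
   ('r, 'm, 'd) state \<Rightarrow> ('r, 'm, 'd, 'f, 's) instr list \<Rightarrow>
   ('r, 'm, 'd) state \<Rightarrow> ('r, 'm, 'd, 'f, 's) instr list \<Rightarrow> bool" where
  "H_equiv H v \<rho> v' \<rho>' \<longleftrightarrow>
     length \<rho> = length \<rho>' \<and>
     (\<forall>k < length \<rho>.
        (\<forall>s \<in> stages H. dur (\<rho> ! k) s = dur (\<rho>' ! k) s) \<and>
        regR (\<rho> ! k) = regR (\<rho>' ! k) \<and>
        regW (\<rho> ! k) = regW (\<rho>' ! k) \<and>
        memR (\<rho> ! k) (state_after v \<rho> k) = memR (\<rho>' ! k) (state_after v' \<rho>' k) \<and>
        memW (\<rho> ! k) (state_after v \<rho> k) = memW (\<rho>' ! k) (state_after v' \<rho>' k))"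

definition architecture :: "('r, 'm, 'd, 'f, 's) arch \<Rightarrow> bool" where
  "architecture H \<longleftrightarrow> (\<forall>v \<rho> v' \<rho>'. H_equiv H v \<rho> v' \<rho>' \<longrightarrow> time H v \<rho> = time H v' \<rho>')"

definition critical :: "('r, 'm, 'd, 'f, 's) instr \<Rightarrow> bool" where
  "critical i \<longleftrightarrow> statW i \<noteq> {} \<or> (\<exists>v. memR i v \<union> memW i v \<noteq> {})"

definition abstr ::
  "('r, 'd::{plus,one}, 'f) cpu \<Rightarrow> ('r, 'm, 'd, 'f, 's) instr \<Rightarrow> ('r, 'm, 'd, 'f, 's) instr" where
  "abstr M i = i\<lparr>sem := (\<lambda>v. v(Inl (pc M) := v (Inl (pc M)) + 1)),
                 statW := {}, branching := False\<rparr>"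

text \<open>\<open>\<alpha> k\<close> is the instruction that replaces the occurrence at position \<open>k\<close>.\<close>
definition abstraction_mapping ::
  "('r, 'd::{plus,one}, 'f) cpu \<Rightarrow> ('r, 'm, 'd, 'f, 's) program
     \<Rightarrow> (nat \<Rightarrow> ('r, 'm, 'd, 'f, 's) instr) \<Rightarrow> bool" where
  "abstraction_mapping M p \<alpha> \<longleftrightarrow> (\<forall>k < length p. \<alpha> k = p ! k \<or> \<alpha> k = abstr M (p ! k))"

definition abstracted_program ::
  "('r, 'm, 'd, 'f, 's) program \<Rightarrow> (nat \<Rightarrow> ('r, 'm, 'd, 'f, 's) instr)
     \<Rightarrow> ('r, 'm, 'd, 'f, 's) program" where
  "abstracted_program p \<alpha> = map \<alpha> [0..<length p]"

text \<open>
  The abstracted run follows the path of the original program: it is the image of the original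
  run, not a run steered by the contents of \<open>pc\<close> in the abstracted states, which are
  meaningless for control flow once tests or branches are abstracted.
\<close>
definition abstracted_run ::
  "('r, 'd, 'f) cpu \<Rightarrow> ('r, 'm, 'd, 'f, 's) program \<Rightarrow> (nat \<Rightarrow> ('r, 'm, 'd, 'f, 's) instr)
     \<Rightarrow> ('r, 'm, 'd) state \<Rightarrow> ('r, 'm, 'd, 'f, 's) instr list" where
  "abstracted_run M p \<alpha> v0 = map ((!) (abstracted_program p \<alpha>)) (path M p v0)"

definition program_equiv ::
  "('r, 'd, 'f) cpu \<Rightarrow> ('r, 'm, 'd) state set \<Rightarrow> ('r, 'm, 'd, 'f, 's) program
     \<Rightarrow> (nat \<Rightarrow> ('r, 'm, 'd, 'f, 's) instr) \<Rightarrow> bool" where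
  "program_equiv M V0 p \<alpha> \<longleftrightarrow>
     (\<forall>v0 \<in> V0. \<forall>j < length (run M p v0).
        critical (run M p v0 ! j) \<longrightarrow>
        (\<forall>r \<in> regR (run M p v0 ! j) \<union> regW (run M p v0 ! j).
           state_after v0 (run M p v0) j (Inl r) =
           state_after v0 (abstracted_run M p \<alpha> v0) j (Inl r)))"

text \<open>The argument \<open>\<rho>\<close> maps an initial state to the run from it.\<close>
definition WCET ::
  "('r, 'm, 'd, 'f, 's) arch \<Rightarrow> ('r, 'm, 'd) state set
     \<Rightarrow> (('r, 'm, 'd) state \<Rightarrow> ('r, 'm, 'd, 'f, 's) instr list) \<Rightarrow> real" where
  "WCET H V0 \<rho> = Max ((\<lambda>v0. time H v0 (\<rho> v0)) ` V0)"

lemma state_after_cong: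
  assumes "take j \<rho> = take j \<rho>'"
  shows "state_after v \<rho> j = state_after v \<rho>' j"
  using assms by (simp add: state_after_def)

lemma is_path_agree:
  assumes "is_path M p v xs" "is_path M p v ys" "length xs \<le> length ys" "j \<le> length xs"
  shows "take j xs = take j ys"
  using assms(4)
proof (induction j)
  case (Suc j)
  then have t: "take j xs = take j ys" and j: "j < length xs" "j < length ys"
    using assms(3) by auto
  have "state_after v (map ((!) p) xs) j = state_after v (map ((!) p) ys) j"
    by (rule state_after_cong) (simp add: take_map t)
  then have "xs ! j = ys ! j"
    using assms(1,2) j unfolding is_path_def by metis
  then show ?case using t j by (simp add: take_Suc_conv_app_nth)
qed simp

lemma is_path_unique_le:
  assumes "is_path M p v xs" "is_path M p v ys" "length xs \<le> length ys"
  shows "xs = ys"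
proof -
  let ?n = "length xs"
  have t: "take ?n xs = take ?n ys"
    using is_path_agree[OF assms order_refl] by simp
  have "state_after v (map ((!) p) xs) ?n = state_after v (map ((!) p) ys) ?n"
    by (rule state_after_cong) (use t in \<open>simp add: take_map\<close>)
  then have "\<not> ?n < length ys"
    using assms(1,2) unfolding is_path_def by (metis not_le)
  then show ?thesis using t assms(3) by simp
qed

lemma is_path_unique:
  assumes "is_path M p v xs" "is_path M p v ys"
  shows "xs = ys"
  using is_path_unique_le assms by (metis nat_le_linear)

lemma path_eq: "is_path M p v xs \<Longrightarrow> path M p v = xs"
  unfolding path_def by (blast intro: the_equality is_path_unique)

lemma run_first:
  assumes "is_path M p v xs" "p \<noteq> []" "ptr M (v (Inl (pc M))) = 0"
  shows "run M p v \<noteq> [] \<and> run M p v ! 0 = p ! 0"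
proof -
  have "xs \<noteq> []" using assms by (auto simp: is_path_def state_after_def)
  moreover from this have "xs ! 0 = 0" using assms by (auto simp: is_path_def state_after_def)
  ultimately show ?thesis by (simp add: run_def path_eq[OF assms(1)])
qed

lemma wf_instr_abstr: "wf_cpu M n \<Longrightarrow> wf_instr M n i \<Longrightarrow> wf_instr M n (abstr M i)"
  unfolding wf_cpu_def wf_instr_def abstr_def by simp

lemma abstracted_run_eq:
  assumes "is_path M p v xs"
  shows "abstracted_run M p \<alpha> v = map \<alpha> xs"
  using assms by (auto simp: abstracted_run_def path_eq[OF assms] abstracted_program_def
      is_path_def in_set_conv_nth)

end

theory Submission imports Defs begin

text \<open>
  An abstraction changes neither durations nor operands, so only the referenced addresses could
  distinguish the two runs. A non-critical instruction references none, and at a critical one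
  program equivalence gives the registers from which the addresses are computed equal contents.
\<close>

lemma wf_instr_addresses_cong:
  assumes "wf_instr M n i"
    and "critical i \<Longrightarrow> \<forall>r \<in> regR i \<union> regW i. v (Inl r) = v' (Inl r)"
  shows "memR i v = memR i v'" "memW i v = memW i v'"
proof -
  have "memR i v = memR i v' \<and> memW i v = memW i v'"
  proof (cases "critical i")
    case True
    then show ?thesis
      using assms(1) assms(2)[OF True] by (simp only: wf_instr_def)
  next
    case False
    then show ?thesis
      by (auto simp: critical_def)
  qed
  then show "memR i v = memR i v'" "memW i v = memW i v'"
    by blast+
qed

text \<open>\<open>abstr\<close> overrides only \<open>sem\<close>, \<open>statW\<close> and
  \<open>branching\<close>. The last two equations are between functions of the state, so the
  addresses actually referenced may still differ when the states do.\<close>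

lemma abstraction_mapping_same:
  assumes "abstraction_mapping M p \<alpha>" "k < length p"
  shows "dur (\<alpha> k) = dur (p ! k)" "regR (\<alpha> k) = regR (p ! k)" "regW (\<alpha> k) = regW (p ! k)"
    "memR (\<alpha> k) = memR (p ! k)" "memW (\<alpha> k) = memW (p ! k)"
  using assms by (auto simp: abstraction_mapping_def abstr_def)

text \<open>Both runs are images of the same path \<open>xs\<close>, so they have equal length and
  can be compared position by position, without relating the full states.\<close>

lemma H_equiv_abstracted_run:
  assumes "wf_program M p" "abstraction_mapping M p \<alpha>" "program_equiv M V0 p \<alpha>"
    and "v \<in> V0" and path: "is_path M p v xs"
  shows "H_equiv H v (run M p v) v (abstracted_run M p \<alpha> v)"
proof -
  let ?\<rho> = "map ((!) p) xs" and ?\<rho>' = "map \<alpha> xs"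
  have run: "run M p v = ?\<rho>" "abstracted_run M p \<alpha> v = ?\<rho>'"
    using path by (simp_all add: run_def path_eq abstracted_run_eq)
  have pos: "xs ! k < length p" if "k < length xs" for k
    using path that by (simp add: is_path_def)
  have regs: "\<forall>r \<in> regR (p ! (xs ! k)) \<union> regW (p ! (xs ! k)).
      state_after v ?\<rho> k (Inl r) = state_after v ?\<rho>' k (Inl r)"
    if "k < length xs" "critical (p ! (xs ! k))" for k
    using bspec[OF assms(3)[unfolded program_equiv_def] assms(4), unfolded run] that by simp
  have wf: "wf_instr M (length p) (p ! (xs ! k))" if "k < length xs" for k
    using assms(1) pos[OF that] by (simp add: wf_program_def)
  \<comment> \<open>Both sides use the address function of the original instruction; only the states
    differ. The passage to \<open>\<alpha> (xs ! k)\<close> is left to the final rewriting.\<close>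
  have "memR (p ! (xs ! k)) (state_after v ?\<rho> k) = memR (p ! (xs ! k)) (state_after v ?\<rho>' k)"
    "memW (p ! (xs ! k)) (state_after v ?\<rho> k) = memW (p ! (xs ! k)) (state_after v ?\<rho>' k)"
    if "k < length xs" for k
    by (rule wf_instr_addresses_cong[OF wf[OF that] regs[OF that]], assumption)+
  then show ?thesis
    unfolding run H_equiv_def by (simp add: abstraction_mapping_same[OF assms(2) pos])
qed

theorem lemma2:
  fixes M :: "('r::finite, 'd::{finite,plus,one}, 'f) cpu"
    and V0 :: "('r, 'm::finite, 'd) state set"
    and p :: "('r, 'm, 'd, 'f, 's) program"
    and H :: "('r, 'm, 'd, 'f, 's) arch"
    and \<alpha> :: "nat \<Rightarrow> ('r, 'm, 'd, 'f, 's) instr"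
  assumes "wf_program M p"
    and "initial_states M V0"
    and "terminating M p V0"
    and "architecture H"
    and "abstraction_mapping M p \<alpha>"
    and "program_equiv M V0 p \<alpha>"
  shows "WCET H V0 (run M p) = WCET H V0 (abstracted_run M p \<alpha>)"
proof -
  have "time H v (run M p v) = time H v (abstracted_run M p \<alpha> v)" if v: "v \<in> V0" for v
  proof -
    \<comment> \<open>\<open>path\<close> is a definite description, so termination is what gives
      \<open>run\<close> and \<open>abstracted_run\<close> their meaning.\<close>
    obtain xs where "is_path M p v xs"
      using assms(3) v unfolding terminating_def by blast
    then have "H_equiv H v (run M p v) v (abstracted_run M p \<alpha> v)"
      by (rule H_equiv_abstracted_run[OF assms(1,5,6) v])
    then show ?thesis
      using assms(4) by (simp add: architecture_def)
  qed
  \<comment> \<open>Times agree for each initial state, so both maxima range over the same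
    set.\<close>
  then have "(\<lambda>v. time H v (run M p v)) ` V0 = (\<lambda>v. time H v (abstracted_run M p \<alpha> v)) ` V0"
    by (rule image_cong[OF refl])
  then show ?thesis
    by (simp only: WCET_def)
qed

end
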